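(* Suppose that axioms (A1), (A2) and (A3) (stated in the context) are satisfied, and let $S$ be the unique substance. Then $S$ contains the first cause of all other things, and $S$ is eternal: there is a first cause $F$, one has $F\subseteq S$, and $S\subseteq E_t$ for every $t\in\mathbb{R}$.
   Context: Time is modelled by $\mathbb{R}$. For each $t\in\mathbb{R}$, $E_t$ is a set (everything existing or having existed before time $t$), and $E_t\subseteq E_{t'}$ whenever $t\le t'$. $\mathcal{P}(E_t)$ is the power set of $E_t$, ordered by inclusion. The law of causality is a time-independent rule $\mathcal{C}$ assigning to every $A\in\bigcup_{t\in\mathbb{R}}\mathcal{P}(E_t)$ a set $\mathcal{C}(A)$ (the cause of $A$), not depending on $t$, with $\mathcal{C}(A)\in\mathcal{P}(E_t)$ whenever $A\in\mathcal{P}(E_t)$. Axiom (A1): for every $t\in\mathbb{R}$, $\mathcal{C}$ restricts to a map $\mathcal{P}(E_t)\to\mathcal{P}(E_t)\setminus\{\emptyset\}$ (every cause is nonempty). Axiom (A2): for every $t\in\mathbb{R}$ and all $A,B\in\mathcal{P}(E_t)$, if $A\subseteq B$ then $\mathcal{C}(A)\subseteq\mathcal{C}(B)$. A substance is a set $S\subseteq E_t$, for some $t\in\mathbb{R}$, such that $\mathcal{C}(S)=S$. Axiom (A3): two different substances have nothing in common, i.e. if $S,S'$ are substances and $S\neq S'$ then $S\cap S'=\emptyset$. Under (A1)--(A3) there is exactly one substance. The first cause is the cause contained in all causes, i.e. a set $F$ of the form $F=\mathcal{C}(B)$ for some $B\in\bigcup_{t}\mathcal{P}(E_t)$ such that $F\subseteq\mathcal{C}(A)$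 for every $t\in\mathbb{R}$ and every $A\subseteq E_t$ (such an $F$ is unique if it exists). A substance is eternal if it is independent of time, i.e. contained in $E_t$ for all $t\in\mathbb{R}$. *)

theory Defs
  imports Complex_Main "HOL-Library.FuncSet"
begin

text \<open>
  The sets of existing things are modelled as subsets \<open>E t\<close> of a type \<open>'a\<close>, indexed by time
  \<open>t :: real\<close>. The law of causality is a single function \<open>C\<close>, which makes it independent of time.
  It is total in HOL, but only its values on subsets of some \<open>E t\<close> carry meaning, and every
  notion below refers to those values only.
\<close>

definition law_of_causality :: "(real \<Rightarrow> 'a set) \<Rightarrow> ('a set \<Rightarrow> 'a set) \<Rightarrow> bool" where
  "law_of_causality E C \<longleftrightarrow> (\<forall>t. C \<in> Pow (E t) \<rightarrow> Pow (E t))"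

definition causes_nonempty :: "(real \<Rightarrow> 'a set) \<Rightarrow> ('a set \<Rightarrow> 'a set) \<Rightarrow> bool" where
  "causes_nonempty E C \<longleftrightarrow> (\<forall>t. C \<in> Pow (E t) \<rightarrow> Pow (E t) - {{}})"

definition causes_monotone :: "(real \<Rightarrow> 'a set) \<Rightarrow> ('a set \<Rightarrow> 'a set) \<Rightarrow> bool" where
  "causes_monotone E C \<longleftrightarrow>
     (\<forall>t. \<forall>A\<in>Pow (E t). \<forall>B\<in>Pow (E t). A \<subseteq> B \<longrightarrow> C A \<subseteq> C B)"

definition substance :: "(real \<Rightarrow> 'a set) \<Rightarrow> ('a set \<Rightarrow> 'a set) \<Rightarrow> 'a set \<Rightarrow> bool" where
  "substance E C S \<longleftrightarrow> (\<exists>t. S \<subseteq> E t) \<and> C S = S"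

definition substances_disjoint :: "(real \<Rightarrow> 'a set) \<Rightarrow> ('a set \<Rightarrow> 'a set) \<Rightarrow> bool" where
  "substances_disjoint E C \<longleftrightarrow>
     (\<forall>S S'. substance E C S \<and> substance E C S' \<and> S \<noteq> S' \<longrightarrow> S \<inter> S' = {})"

definition first_cause :: "(real \<Rightarrow> 'a set) \<Rightarrow> ('a set \<Rightarrow> 'a set) \<Rightarrow> 'a set \<Rightarrow> bool" where
  "first_cause E C F \<longleftrightarrow>
     (\<exists>B\<in>(\<Union>t. Pow (E t)). F = C B) \<and> (\<forall>t. \<forall>A. A \<subseteq> E t \<longrightarrow> F \<subseteq> C A)"

definition eternal :: "(real \<Rightarrow> 'a set) \<Rightarrow> 'a set \<Rightarrow> bool" where
  "eternal E S \<longleftrightarrow> (\<forall>t. S \<subseteq> E t)"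

end

theory Submission
  imports Defs
begin

text \<open>
  By monotonicity the cause of nothing, \<open>C {}\<close>, lies in every cause, so it is the first cause. A
  substance is its own cause and therefore contains \<open>C {}\<close>, which is nonempty; hence two
  substances always meet, and disjointness of different substances leaves only one. On the other
  hand, \<open>C\<close> is a monotone self-map of the complete lattice \<open>Pow (E t)\<close> for each \<open>t\<close>, so by
  Knaster--Tarski some substance already lies in \<open>E t\<close>. By uniqueness this is always the same
  substance, which is therefore eternal.
\<close>

lemma first_cause_empty:
  assumes "causes_monotone E C"
  shows "first_cause E C (C {})"
  unfolding first_cause_def
proof (intro conjI allI impI)
  show "\<exists>B\<in>(\<Union>t. Pow (E t)). C {} = C B" by blast
  show "C {} \<subseteq> C A" if "A \<subseteq> E t" for t A
    using assms that unfolding causes_monotone_def by simp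
qed

lemma first_cause_subset_substance:
  assumes "first_cause E C F" and "substance E C S"
  shows "F \<subseteq> S"
proof -
  obtain t where "S \<subseteq> E t" and "C S = S"
    using assms(2) unfolding substance_def by blast
  then show ?thesis
    using assms(1) unfolding first_cause_def by metis
qed

lemma substance_unique:
  assumes "causes_nonempty E C" and "causes_monotone E C" and "substances_disjoint E C"
    and "substance E C S" and "substance E C S'"
  shows "S = S'"
proof (rule ccontr)
  assume "S \<noteq> S'"
  then have "S \<inter> S' = {}"
    using assms(3-5) unfolding substances_disjoint_def by simp
  moreover have "C {} \<subseteq> S \<inter> S'"
    using first_cause_subset_substance[OF first_cause_empty[OF assms(2)]] assms(4,5) by simp
  moreover have "C {} \<noteq> {}"
    using assms(1) unfolding causes_nonempty_def Pi_iff by simp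
  ultimately show False by blast
qed

text \<open>
  The Knaster--Tarski theorem for the lattice \<open>Pow (E t)\<close>. Intersecting the argument with \<open>E t\<close>
  turns \<open>C\<close> into a monotone operator on all sets of the type, to which \<open>lfp\<close> applies; its values
  lie in \<open>E t\<close>, so its fixed points are fixed points of \<open>C\<close> itself.
\<close>
lemma ex_substance_at:
  assumes "law_of_causality E C" and "causes_monotone E C"
  obtains S where "substance E C S" and "S \<subseteq> E t"
proof -
  define f where "f X = C (X \<inter> E t)" for X
  have "mono f"
  proof (rule monoI)
    fix X Y :: "'a set"
    assume "X \<subseteq> Y"
    then have "X \<inter> E t \<subseteq> Y \<inter> E t" by blast
    then show "f X \<subseteq> f Y"
      using assms(2) unfolding f_def causes_monotone_def by (meson Int_lower2 PowI)
  qed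
  then have fix_f: "f (lfp f) = lfp f"
    by (rule lfp_unfold[symmetric])
  have "f (lfp f) \<subseteq> E t"
    using assms(1) unfolding f_def law_of_causality_def Pi_iff by (simp add: Ball_def)
  then have sub: "lfp f \<subseteq> E t"
    by (simp add: fix_f)
  then have "C (lfp f) = lfp f"
    using fix_f unfolding f_def by (simp add: Int_absorb2)
  with sub show ?thesis
    using that unfolding substance_def by blast
qed

theorem corollary1:
  fixes E :: "real \<Rightarrow> 'a set" and C :: "'a set \<Rightarrow> 'a set" and S :: "'a set"
  assumes "mono E"
    and "law_of_causality E C"
    and A1: "causes_nonempty E C"
    and A2: "causes_monotone E C"
    and A3: "substances_disjoint E C"
    and "substance E C S"
  shows "(\<exists>F. first_cause E C F \<and> F \<subseteq> S) \<and> eternal E S"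
proof
  show "\<exists>F. first_cause E C F \<and> F \<subseteq> S"
    using first_cause_empty[OF A2] first_cause_subset_substance \<open>substance E C S\<close> by blast
  show "eternal E S"
    unfolding eternal_def
  proof
    fix t
    obtain S' where "substance E C S'" and "S' \<subseteq> E t"
      using ex_substance_at[OF \<open>law_of_causality E C\<close> A2] .
    then show "S \<subseteq> E t"
      using substance_unique[OF A1 A2 A3 \<open>substance E C S\<close>] by blast
  qed
qed

end
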